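(* Let $n\ge3$ be an integer, $Y_0>0$, and let $\tilde H:[0,Y_0]\to\mathbb{R}$ be a (measurable) function. (i) Suppose that $\tilde H$ is bounded. Then for all sufficiently large $M>0$ and all sufficiently small $Y\in(0,Y_0]$ (how small depending on $M$), there exists a unique $q\in X_{Y,M}$ satisfying the integral equation $$q(y)=y^{2-n}\int_0^y\Bigl\{-(n-2)q(\eta)^3+(n-1)\tilde H(\eta)\,\eta\,\bigl(1+q(\eta)^2\bigr)^{3/2}\Bigr\}\eta^{n-3}\,d\eta,\qquad y\in(0,Y].$$ (ii) Suppose that $\tilde H$ is bounded and continuous. Then the function $q$ obtained in (i) is a solution of the singular initial value problem $$y\frac{dq}{dy}=-(n-2)q-(n-2)q^3+(n-1)\tilde H(y)\,y\,(1+q^2)^{3/2}\quad (0<y\le Y),\qquad q(0)=0.$$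
   Context: For $Y,M>0$: $\|q\|_X=\sup_{y\in(0,Y]}|q(y)/y|$, $X_Y=\{q\in C((0,Y]): \|q\|_X<\infty\}$, a Banach space, and $X_{Y,M}=\{q\in X_Y:\|q\|_X\le M\}$. Every $q\in X_Y$ is extended continuously to $[0,Y]$ by $q(0)=0$. *)

theory Defs
  imports "HOL-Analysis.Analysis"
begin

definition X_norm :: "real \<Rightarrow> (real \<Rightarrow> real) \<Rightarrow> real" where
  "X_norm Y q = (SUP y\<in>{0<..Y}. \<bar>q y / y\<bar>)"

(* A function on (0,Y] is represented by the total function that vanishes off (0,Y], so that
   equality of representatives is equality on (0,Y].  The same representative also carries the
   extension to [0,Y] by q(0) = 0.  Boundedness is required separately because the supremum in
   X_norm is unspecified for unbounded sets. *)
definition X_space :: "real \<Rightarrow> (real \<Rightarrow> real) set" where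
  "X_space Y = {q. continuous_on {0<..Y} q
                 \<and> bdd_above ((\<lambda>y. \<bar>q y / y\<bar>) ` {0<..Y})
                 \<and> (\<forall>y. y \<notin> {0<..Y} \<longrightarrow> q y = 0)}"

definition X_ball :: "real \<Rightarrow> real \<Rightarrow> (real \<Rightarrow> real) set" where
  "X_ball Y M = {q \<in> X_space Y. X_norm Y q \<le> M}"

(* The truncated exponent n - 3 is harmless, as n is at least 3 throughout.  For q in X_space Y,
   Y \<le> Y0, and H bounded and Lebesgue measurable on [0,Y0], the integrand is bounded and
   measurable on [0,y], so the integral never takes its default value. *)
definition solves_integral_eq ::
    "nat \<Rightarrow> (real \<Rightarrow> real) \<Rightarrow> real \<Rightarrow> (real \<Rightarrow> real) \<Rightarrow> bool" where
  "solves_integral_eq n H Y q \<longleftrightarrow>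
     (\<forall>y\<in>{0<..Y}.
        q y = y powi (2 - int n) *
          (LINT t:{0..y}|lebesgue.
             (- (real n - 2) * q t ^ 3
              + (real n - 1) * H t * t * (1 + (q t)\<^sup>2) powr (3/2)) * t ^ (n - 3)))"

(* The initial condition is attained continuously; at y = Y the derivative is one-sided. *)
definition solves_singular_ivp ::
    "nat \<Rightarrow> (real \<Rightarrow> real) \<Rightarrow> real \<Rightarrow> (real \<Rightarrow> real) \<Rightarrow> bool" where
  "solves_singular_ivp n H Y q \<longleftrightarrow>
     continuous_on {0..Y} q \<and> q 0 = 0 \<and>
     (\<forall>y\<in>{0<..Y}. \<exists>q'. (q has_real_derivative q') (at y within {0<..Y}) \<and>
        y * q' = - (real n - 2) * q y - (real n - 2) * q y ^ 3
                 + (real n - 1) * H y * y * (1 + (q y)\<^sup>2) powr (3/2))"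

end

theory Submission
  imports Defs
begin

text \<open>
  If \<open>\<bar>H\<bar> \<le> B\<close> and \<open>\<bar>q \<eta>\<bar> \<le> M \<eta>\<close> with \<open>M Y \<le> 1\<close>, the bracket in the integral equation is at
  most \<open>(n - 1) (M\<^sup>3 Y\<^sup>2 + 3 B) \<eta>\<close>, and the weight \<open>y\<^bsup>2-n\<^esup> \<integral> \<eta>\<^bsup>n-3\<^esup>\<close> turns a bound
  \<open>(n - 1) C \<eta>\<close> into \<open>C y\<close>.  So \<open>M \<ge> 3 B + 1\<close> and small \<open>Y\<close> make the right-hand side a
  self-map, and the same computation for differences makes it a contraction with factor
  \<open>1/2\<close>.  The iteration is run on measurable functions, a class closed under pointwise limits;
  continuity of the fixed point then comes for free, being that of an indefinite integral.
  For continuous \<open>H\<close> the integral equation is differentiated.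
\<close>

section \<open>Fixed points of contractions in a weighted supremum norm\<close>

text \<open>Banach's fixed point theorem for the norm with weight \<open>w\<close>. Completeness
  enters as closure of \<open>S\<close> under pointwise limits, and \<open>bound\<close> keeps any
  two elements of \<open>S\<close> within weighted distance \<open>2 * M\<close>, so iterates
  approach each other geometrically.\<close>

lemma weighted_contraction_fixed_point:
  fixes T :: "('a \<Rightarrow> real) \<Rightarrow> 'a \<Rightarrow> real" and w :: "'a \<Rightarrow> real"
  assumes q0: "q0 \<in> S" and maps: "\<And>f. f \<in> S \<Longrightarrow> T f \<in> S"
    and bound: "\<And>f t. f \<in> S \<Longrightarrow> \<bar>f t\<bar> \<le> M * w t"
    and closed: "\<And>F g. (\<And>k. F k \<in> S) \<Longrightarrow> (\<And>t. (\<lambda>k::nat. F k t) \<longlonglongrightarrow> g t) \<Longrightarrow> g \<in> S"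
    and contr: "\<And>f g D t. f \<in> S \<Longrightarrow> g \<in> S \<Longrightarrow> (\<And>s. \<bar>f s - g s\<bar> \<le> D * w s)
                  \<Longrightarrow> \<bar>T f t - T g t\<bar> \<le> D / 2 * w t"
  shows "\<exists>!q. q \<in> S \<and> T q = q"
proof -
  have inS: "(T ^^ k) f \<in> S" if "f \<in> S" for f k
    using that by (induction k) (auto intro: maps)
  \<comment> \<open>Both starting points are arbitrary: this one estimate yields the Cauchy property
    as well as uniqueness.\<close>
  have iter: "\<bar>(T ^^ k) f t - (T ^^ k) g t\<bar> \<le> 2 * M / 2 ^ k * w t" if "f \<in> S" "g \<in> S" for f g k t
  proof (induction k arbitrary: t)
    case 0
    show ?case using bound[OF that(1), of t] bound[OF that(2), of t] by simp
  next
    case (Suc k)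
    show ?case using contr[OF inS[OF that(1)] inS[OF that(2)] Suc.IH, of t] by (simp add: mult.commute)
  qed
  have lim0: "(\<lambda>k. 2 * M / 2 ^ k * w t) \<longlonglongrightarrow> 0" for t
    using tendsto_mult[OF tendsto_const[of "2 * M * w t"] LIMSEQ_power_zero[of "1/2 :: real"]]
    by (simp add: power_divide)
  define F where "F k = (T ^^ k) q0" for k
  have FS: "F k \<in> S" for k unfolding F_def by (rule inS[OF q0])
  \<comment> \<open>\<open>F (k + j)\<close> is the \<open>k\<close>-th iterate of
    \<open>F j\<close>, so \<open>iter\<close> compares the starting points \<open>F j\<close> and
    \<open>q0\<close>.\<close>
  have tail: "\<bar>F (k + j) t - F k t\<bar> \<le> 2 * M / 2 ^ k * w t" for k j t
    using iter[OF FS[of j] q0, of k t] by (simp add: F_def funpow_add)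
  have "Cauchy (\<lambda>k. F k t)" for t
  proof (rule metric_CauchyI)
    fix e :: real assume "e > 0"
    with lim0[of t] have "\<forall>\<^sub>F k in sequentially. 2 * M / 2 ^ k * w t < e / 2"
      by (intro order_tendstoD) auto
    then obtain N where N: "2 * M / 2 ^ N * w t < e / 2"
      by (auto simp: eventually_sequentially)
    have near: "\<bar>F m t - F N t\<bar> < e / 2" if "m \<ge> N" for m
      using tail[of N "m - N" t] N that by simp
    show "\<exists>N. \<forall>m\<ge>N. \<forall>k\<ge>N. dist (F m t) (F k t) < e"
    proof (intro exI allI impI)
      fix m k assume "N \<le> m" "N \<le> k"
      then show "dist (F m t) (F k t) < e"
        using near[of m] near[of k] unfolding dist_real_def by linarith
    qed
  qed
  then have "\<exists>l. (\<lambda>k. F k t) \<longlonglongrightarrow> l" for t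
    by (simp add: Cauchy_convergent_iff convergent_def)
  then obtain g where g: "\<And>t. (\<lambda>k. F k t) \<longlonglongrightarrow> g t" by metis
  have gS: "g \<in> S" by (rule closed[OF FS g])
  \<comment> \<open>Letting \<open>j\<close> tend to infinity in \<open>tail\<close> gives one
    constant valid at every \<open>t\<close>. This uniformity is what allows \<open>contr\<close> to
    be applied to \<open>g\<close> and \<open>F k\<close>; pointwise convergence alone does
    not.\<close>
  have gF: "\<bar>g t - F k t\<bar> \<le> 2 * M / 2 ^ k * w t" for k t
  proof (rule LIMSEQ_le_const2)
    show "(\<lambda>j. \<bar>F (j + k) t - F k t\<bar>) \<longlonglongrightarrow> \<bar>g t - F k t\<bar>"
      by (intro tendsto_intros LIMSEQ_ignore_initial_segment g)
    show "\<exists>N. \<forall>j\<ge>N. \<bar>F (j + k) t - F k t\<bar> \<le> 2 * M / 2 ^ k * w t"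
      using tail[of k _ t] by (simp add: add.commute)
  qed
  have "T g t = g t" for t
  proof -
    have near: "norm (T g t - F (Suc k) t) \<le> 2 * M / 2 ^ k / 2 * w t" for k
      using contr[OF gS FS[of k] gF, of t] by (simp add: F_def)
    have "(\<lambda>k. 2 * M / 2 ^ k / 2 * w t) \<longlonglongrightarrow> 0"
      using tendsto_divide[OF lim0[of t] tendsto_const[of 2]] by (simp add: ac_simps)
    then have "(\<lambda>k. T g t - F (Suc k) t) \<longlonglongrightarrow> 0"
      by (rule Lim_null_comparison[OF always_eventually[OF allI[OF near]]])
    moreover have "(\<lambda>k. T g t - F (Suc k) t) \<longlonglongrightarrow> T g t - g t"
      by (intro tendsto_intros LIMSEQ_Suc g)
    ultimately show ?thesis
      using LIMSEQ_unique by fastforce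
  qed
  then have fixed: "T g = g" by auto
  show ?thesis
  proof (intro ex1I conjI)
    fix h assume h: "h \<in> S \<and> T h = h"
    \<comment> \<open>Iteration leaves fixed points where they are, so \<open>iter\<close> bounds
      the distance of two of them by a null sequence.\<close>
    have pw: "(T ^^ k) f = f" if "T f = f" for k f
      using that by (induction k) auto
    show "h = g"
    proof
      fix t
      have "\<bar>h t - g t\<bar> \<le> 2 * M / 2 ^ k * w t" for k
        using iter[of h g k t] h gS pw fixed by simp
      then have "\<bar>h t - g t\<bar> \<le> 0"
        by (intro LIMSEQ_le_const[OF lim0[of t]]) auto
      then show "h t = g t" by simp
    qed
  qed (use gS fixed in auto)
qed

section \<open>Elementary estimates for the nonlinear terms\<close>

lemma powr_three_halves: "(1 + x\<^sup>2) powr (3/2) = (1 + x\<^sup>2) * sqrt (1 + x\<^sup>2)" for x :: real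
proof -
  have "1 + x\<^sup>2 > 0" by (simp add: add_pos_nonneg)
  then show ?thesis
    using powr_add[of "1 + x\<^sup>2" 1 "1/2"] by (simp add: powr_half_sqrt)
qed

text \<open>A rational bound for the square root of 2. With \<open>1 + x\<^sup>2 \<le> 2\<close> it
  produces the factor 3 in the threshold \<open>3 * B + 1\<close>.\<close>

lemma sqrt_one_plus_square_le:
  fixes x :: real
  assumes "\<bar>x\<bar> \<le> 1"
  shows "sqrt (1 + x\<^sup>2) \<le> 3/2"
  using abs_square_le_1[of x] assms by (intro real_le_lsqrt) (auto simp: power2_eq_square)

lemma powr_three_halves_le:
  fixes x :: real
  assumes "\<bar>x\<bar> \<le> 1"
  shows "(1 + x\<^sup>2) powr (3/2) \<le> 3"
proof -
  have "(1 + x\<^sup>2) * sqrt (1 + x\<^sup>2) \<le> 2 * (3/2)"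
    using abs_square_le_1[of x] assms
    by (intro mult_mono sqrt_one_plus_square_le) auto
  then show ?thesis by (simp add: powr_three_halves)
qed

text \<open>The root is the modulus of the complex number with real part 1 and imaginary part
  \<open>x\<close>, so this is the reverse triangle inequality.\<close>

lemma sqrt_one_plus_square_Lipschitz: "\<bar>sqrt (1 + x\<^sup>2) - sqrt (1 + y\<^sup>2)\<bar> \<le> \<bar>x - y\<bar>" for x y :: real
  using norm_triangle_ineq3[of "Complex 1 x" "Complex 1 y"] by (simp add: complex_norm complex_diff)

text \<open>Splitting the difference of the products \<open>(1 + x\<^sup>2) * r\<close> and
  \<open>(1 + y\<^sup>2) * s\<close> gives the constant 2 from the change of root and
  \<open>3/2 * 2\<close> from the change of polynomial factor.\<close>

lemma powr_three_halves_Lipschitz: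
  fixes x y :: real
  assumes "\<bar>x\<bar> \<le> 1" "\<bar>y\<bar> \<le> 1"
  shows "\<bar>(1 + x\<^sup>2) powr (3/2) - (1 + y\<^sup>2) powr (3/2)\<bar> \<le> 5 * \<bar>x - y\<bar>"
proof -
  define r s where "r = sqrt (1 + x\<^sup>2)" and "s = sqrt (1 + y\<^sup>2)"
  have s: "0 \<le> s" "s \<le> 3/2" using sqrt_one_plus_square_le assms by (auto simp: s_def)
  have x2: "0 \<le> 1 + x\<^sup>2" "1 + x\<^sup>2 \<le> 2" using abs_square_le_1[of x] assms by auto
  have "(1 + x\<^sup>2) * r - (1 + y\<^sup>2) * s = (1 + x\<^sup>2) * (r - s) + s * ((x + y) * (x - y))"
    by (simp add: algebra_simps power2_eq_square)
  also have "\<bar>\<dots>\<bar> \<le> (1 + x\<^sup>2) * \<bar>r - s\<bar> + s * (\<bar>x + y\<bar> * \<bar>x - y\<bar>)"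
    using s x2 by (intro order_trans[OF abs_triangle_ineq]) (simp add: abs_mult)
  also have "\<dots> \<le> 2 * \<bar>x - y\<bar> + 3/2 * (2 * \<bar>x - y\<bar>)"
    using s x2 assms sqrt_one_plus_square_Lipschitz[of x y]
    by (intro add_mono mult_mono mult_nonneg_nonneg) (auto simp: r_def s_def)
  finally show ?thesis by (simp add: powr_three_halves r_def s_def)
qed

lemma cube_Lipschitz:
  fixes x y :: real
  assumes "\<bar>x\<bar> \<le> c" "\<bar>y\<bar> \<le> c"
  shows "\<bar>x ^ 3 - y ^ 3\<bar> \<le> 3 * c\<^sup>2 * \<bar>x - y\<bar>"
proof -
  have c: "0 \<le> c" using assms by linarith
  have "x ^ 3 - y ^ 3 = (x * x + x * y + y * y) * (x - y)"
    by (simp add: algebra_simps power3_eq_cube)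
  moreover have "\<bar>x * x + x * y + y * y\<bar> \<le> c * c + c * c + c * c"
    using assms c mult_mono[of "\<bar>x\<bar>" c "\<bar>x\<bar>" c] mult_mono[of "\<bar>x\<bar>" c "\<bar>y\<bar>" c]
      mult_mono[of "\<bar>y\<bar>" c "\<bar>y\<bar>" c]
      abs_triangle_ineq[of "x * x + x * y" "y * y"] abs_triangle_ineq[of "x * x" "x * y"]
    by (simp add: abs_mult)
  ultimately show ?thesis
    by (simp add: abs_mult power2_eq_square mult_right_mono)
qed

section \<open>Pointwise form of the norm and the weighted mean\<close>

text \<open>Trades the supremum for a pointwise bound. Forwards, the boundedness clause of
  \<open>X_space\<close> makes the supremum an upper bound; backwards, \<open>Y > 0\<close> makes
  the index set nonempty.\<close>

lemma X_ball_iff: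
  assumes "Y > 0"
  shows "q \<in> X_ball Y M \<longleftrightarrow> continuous_on {0<..Y} q \<and> (\<forall>y\<in>{0<..Y}. \<bar>q y\<bar> \<le> M * y)
           \<and> (\<forall>y. y \<notin> {0<..Y} \<longrightarrow> q y = 0)"
proof -
  have eq: "\<bar>q y / y\<bar> \<le> M \<longleftrightarrow> \<bar>q y\<bar> \<le> M * y" if "y \<in> {0<..Y}" for y
    using that by (simp add: field_simps)
  have ne: "{0<..Y} \<noteq> {}" using assms by auto
  show ?thesis
  proof
    assume "q \<in> X_ball Y M"
    then have q: "q \<in> X_space Y" "X_norm Y q \<le> M" by (auto simp: X_ball_def)
    have "\<bar>q y / y\<bar> \<le> M" if "y \<in> {0<..Y}" for y
      using q cSUP_upper[OF that, of "\<lambda>y. \<bar>q y / y\<bar>"] unfolding X_norm_def X_space_def by simp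
    with q eq show "continuous_on {0<..Y} q \<and> (\<forall>y\<in>{0<..Y}. \<bar>q y\<bar> \<le> M * y)
           \<and> (\<forall>y. y \<notin> {0<..Y} \<longrightarrow> q y = 0)"
      by (auto simp: X_space_def)
  next
    assume r: "continuous_on {0<..Y} q \<and> (\<forall>y\<in>{0<..Y}. \<bar>q y\<bar> \<le> M * y)
           \<and> (\<forall>y. y \<notin> {0<..Y} \<longrightarrow> q y = 0)"
    then have "X_norm Y q \<le> M" unfolding X_norm_def
      using ne eq by (intro cSUP_least) auto
    moreover have "bdd_above ((\<lambda>y. \<bar>q y / y\<bar>) ` {0<..Y})"
      using r eq by (intro bdd_aboveI[of _ M]) auto
    ultimately show "q \<in> X_ball Y M" using r by (auto simp: X_ball_def X_space_def)
  qed
qed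

text \<open>The bound on \<open>f\<close> has the antiderivative \<open>C * t ^ (n - 1)\<close>,
  which vanishes at 0; the weight then cancels \<open>y ^ (n - 2)\<close>. Self-mapping uses
  \<open>C = M\<close>, contraction \<open>C = D / 2\<close>.\<close>

lemma weighted_mean_bound:
  fixes f :: "real \<Rightarrow> real"
  assumes n: "n \<ge> 3" and y: "y > 0"
    and f: "f absolutely_integrable_on {0..y}"
    and bound: "\<And>t. t \<in> {0..y} \<Longrightarrow> \<bar>f t\<bar> \<le> (real n - 1) * C * t ^ (n - 2)"
  shows "\<bar>y powi (2 - int n) * (LINT t:{0..y}|lebesgue. f t)\<bar> \<le> C * y"
proof -
  have deriv: "((\<lambda>t. C * t ^ (n - 1)) has_vector_derivative (real n - 1) * C * t ^ (n - 2))
      (at t within {0..y})" for t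
  proof -
    have "((\<lambda>t. C * t ^ (n - 1)) has_real_derivative C * (real (n - 1) * t ^ (n - 1 - 1)))
        (at t within {0..y})"
      using DERIV_cmult[OF DERIV_pow[of "n - 1" t "{0..y}"], of C] by simp
    moreover have "n - 1 - 1 = n - 2" "real (n - 1) = real n - 1" using n by auto
    ultimately show ?thesis
      by (simp add: has_real_derivative_iff_has_vector_derivative ac_simps)
  qed
  have int: "((\<lambda>t. (real n - 1) * C * t ^ (n - 2)) has_integral C * y ^ (n - 1)) {0..y}"
    using fundamental_theorem_of_calculus[OF less_imp_le[OF y] deriv] n by (simp add: zero_power)
  have "\<bar>LINT t:{0..y}|lebesgue. f t\<bar> = \<bar>integral {0..y} f\<bar>"
    using f by (simp add: set_lebesgue_integral_eq_integral)
  also have "\<dots> \<le> integral {0..y} (\<lambda>t. (real n - 1) * C * t ^ (n - 2))"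
    using integral_norm_bound_integral[OF set_lebesgue_integral_eq_integral(1)[OF f]
      has_integral_integrable[OF int]] bound by (simp only: real_norm_def)
  also have "\<dots> = C * y ^ (n - 1)" using int by (rule integral_unique)
  also have "\<dots> = C * y * y ^ (n - 2)"
  proof -
    have "n - 1 = Suc (n - 2)" using n by simp
    then show ?thesis by simp
  qed
  finally have I: "\<bar>LINT t:{0..y}|lebesgue. f t\<bar> \<le> C * y * y ^ (n - 2)" .
  have p: "y powi (2 - int n) = inverse (y ^ (n - 2))"
    using n by (simp add: power_int_def nat_diff_distrib power_inverse)
  show ?thesis
    using I y by (simp add: p abs_mult field_simps)
qed

section \<open>The integral operator and pointwise bounds for its integrand\<close>

definition bracket :: "nat \<Rightarrow> (real \<Rightarrow> real) \<Rightarrow> real \<Rightarrow> real \<Rightarrow> real" where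
  "bracket n H t x = - (real n - 2) * x ^ 3 + (real n - 1) * H t * t * (1 + x\<^sup>2) powr (3/2)"

text \<open>Cutting off to 0 outside \<open>(0,Y]\<close> matches the representatives in
  \<open>X_space\<close>, so that solutions of the integral equation are fixed points as total
  functions.\<close>

definition picard :: "nat \<Rightarrow> (real \<Rightarrow> real) \<Rightarrow> real \<Rightarrow> (real \<Rightarrow> real) \<Rightarrow> real \<Rightarrow> real" where
  "picard n H Y q y = (if y \<in> {0<..Y} then y powi (2 - int n) *
     (LINT t:{0..y}|lebesgue. bracket n H t (q t) * t ^ (n - 3)) else 0)"

lemma solves_integral_eq_iff:
  assumes "\<And>y. y \<notin> {0<..Y} \<Longrightarrow> q y = 0"
  shows "solves_integral_eq n H Y q \<longleftrightarrow> picard n H Y q = q"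
  using assms unfolding solves_integral_eq_def picard_def bracket_def fun_eq_iff by auto

locale small_interval =
  fixes n :: nat and H :: "real \<Rightarrow> real" and B M Y :: real
  assumes n: "n \<ge> 3" and Y: "Y > 0"
    and meas: "H \<in> borel_measurable (lebesgue_on {0..Y})"
    and B: "\<And>t. t \<in> {0..Y} \<Longrightarrow> \<bar>H t\<bar> \<le> B"
    and MB: "3 * B + 1 \<le> M"
    and YM: "Y * (12 * M\<^sup>2 + 20 * B) \<le> 1"
begin

text \<open>The ball \<open>X_ball Y M\<close> with continuity weakened to Lebesgue measurability.
  The weight is 0 off \<open>(0,Y]\<close>, which forces the functions to vanish there.\<close>

definition admissible :: "(real \<Rightarrow> real) set" where
  "admissible = {q \<in> borel_measurable lebesgue. \<forall>t. \<bar>q t\<bar> \<le> M * (if t \<in> {0<..Y} then t else 0)}"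

lemma B_nonneg: "0 \<le> B"
  using B[of Y] Y by auto

lemma M_ge_1: "1 \<le> M"
  using MB B_nonneg by simp

text \<open>The first bound brings the values of \<open>q\<close> into \<open>[-1,1]\<close>, the
  second absorbs the cubic term in the self-map estimate, the third is the contraction factor. The
  coefficients 12 and 20 in \<open>YM\<close> are four times the Lipschitz coefficients 3 and
  5.\<close>

lemma Y_bounds: "M * Y \<le> 1" "M ^ 3 * Y\<^sup>2 \<le> 1" "3 * M\<^sup>2 * Y\<^sup>2 + 5 * B * Y \<le> 1 / 2"
proof -
  have a: "M\<^sup>2 * Y \<le> 1 / 12" and b: "20 * B * Y \<le> 1 - 12 * (M\<^sup>2 * Y)"
    using YM B_nonneg Y by (auto simp: algebra_simps) (smt (verit) mult_nonneg_nonneg)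
  have M2: "M \<le> M\<^sup>2" using M_ge_1 by (simp add: power2_eq_square)
  then have c: "M * Y \<le> M\<^sup>2 * Y" using Y by simp
  then show d: "M * Y \<le> 1" using a by linarith
  have e: "Y \<le> M * Y" using M_ge_1 Y by simp
  have "(M\<^sup>2 * Y) * (M * Y) \<le> 1 * 1" using a d Y M_ge_1 by (intro mult_mono) auto
  then show "M ^ 3 * Y\<^sup>2 \<le> 1" by (simp add: power2_eq_square power3_eq_cube ac_simps)
  have "(M\<^sup>2 * Y) * Y \<le> M\<^sup>2 * Y * 1" using d e Y by (intro mult_left_mono order_trans[OF e d]) auto
  then have "3 * M\<^sup>2 * Y\<^sup>2 \<le> 3 * (M\<^sup>2 * Y)" by (simp add: power2_eq_square)
  then show "3 * M\<^sup>2 * Y\<^sup>2 + 5 * B * Y \<le> 1 / 2" using a b by linarith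
qed

text \<open>The cubic term contributes at most \<open>(real n - 1) * t\<close> because
  \<open>M ^ 3 * Y\<^sup>2 \<le> 1\<close>, the curvature term at most \<open>3 * B\<close> times
  this; \<open>MB\<close> bounds the sum.\<close>

lemma bracket_bound:
  assumes t: "t \<in> {0..Y}" and x: "\<bar>x\<bar> \<le> M * t"
  shows "\<bar>bracket n H t x\<bar> \<le> (real n - 1) * M * t"
proof -
  have Mt: "M * t \<le> 1" using Y_bounds(1) t M_ge_1 by (smt (verit) atLeastAtMost_iff mult_left_mono)
  have "\<bar>x\<bar> ^ 3 \<le> (M * t) ^ 3" using x by (intro power_mono) auto
  also have "\<dots> = M ^ 3 * t\<^sup>2 * t" by (simp add: power_mult_distrib power2_eq_square power3_eq_cube)
  also have "\<dots> \<le> M ^ 3 * Y\<^sup>2 * t"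
    using t M_ge_1 by (intro mult_mono power_mono) auto
  also have "\<dots> \<le> t" using Y_bounds(2) t mult_right_mono[of "M ^ 3 * Y\<^sup>2" 1 t] by simp
  finally have 1: "(real n - 2) * \<bar>x\<bar> ^ 3 \<le> (real n - 1) * t" using n t by (intro mult_mono) auto
  have 2: "\<bar>H t\<bar> * t * (1 + x\<^sup>2) powr (3/2) \<le> B * t * 3"
    using B[OF t] B_nonneg t x Mt by (intro mult_mono powr_three_halves_le) auto
  have "\<bar>bracket n H t x\<bar> \<le> (real n - 2) * \<bar>x\<bar> ^ 3 + (real n - 1) * (\<bar>H t\<bar> * t * (1 + x\<^sup>2) powr (3/2))"
    unfolding bracket_def using n t
    by (intro order_trans[OF abs_triangle_ineq]) (simp add: abs_mult power_abs)
  also have "\<dots> \<le> (real n - 1) * t + (real n - 1) * (B * t * 3)"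
    using 1 2 n by (intro add_mono mult_left_mono) auto
  also have "\<dots> = (real n - 1) * (3 * B + 1) * t" by (simp add: algebra_simps)
  also have "\<dots> \<le> (real n - 1) * M * t" using MB n t by (intro mult_right_mono mult_left_mono) auto
  finally show ?thesis .
qed

text \<open>Enlarging \<open>real n - 2\<close> to \<open>real n - 1\<close> extracts the common
  factor that the weighted mean cancels, leaving the contraction factor
  \<open>1 / 2\<close>.\<close>

lemma bracket_Lipschitz:
  assumes t: "t \<in> {0..Y}" and x: "\<bar>x\<bar> \<le> M * t" and z: "\<bar>z\<bar> \<le> M * t"
  shows "\<bar>bracket n H t x - bracket n H t z\<bar> \<le> (real n - 1) * (1 / 2) * \<bar>x - z\<bar>"
proof -
  have Mt: "M * t \<le> M * Y" using t M_ge_1 by simp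
  let ?p = "\<lambda>x. (1 + x\<^sup>2) powr (3/2)"
  have xz: "\<bar>x\<bar> \<le> M * Y" "\<bar>z\<bar> \<le> M * Y" using x z Mt by linarith+
  have cube: "\<bar>x ^ 3 - z ^ 3\<bar> \<le> 3 * (M * Y)\<^sup>2 * \<bar>x - z\<bar>" by (rule cube_Lipschitz[OF xz])
  have powr: "\<bar>?p x - ?p z\<bar> \<le> 5 * \<bar>x - z\<bar>"
    by (rule powr_three_halves_Lipschitz) (use xz Y_bounds(1) in linarith)+
  have "bracket n H t x - bracket n H t z
      = - ((real n - 2) * (x ^ 3 - z ^ 3)) + (real n - 1) * (H t * t * (?p x - ?p z))"
    by (simp add: bracket_def algebra_simps)
  also have "\<bar>\<dots>\<bar> \<le> (real n - 2) * \<bar>x ^ 3 - z ^ 3\<bar> + (real n - 1) * (\<bar>H t\<bar> * t * \<bar>?p x - ?p z\<bar>)"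
    using n t by (intro order_trans[OF abs_triangle_ineq]) (simp add: abs_mult)
  also have "\<dots> \<le> (real n - 1) * (3 * (M * Y)\<^sup>2 * \<bar>x - z\<bar>) + (real n - 1) * (B * Y * (5 * \<bar>x - z\<bar>))"
  proof -
    have "\<bar>H t\<bar> * t \<le> B * Y"
      by (rule mult_mono) (use B[OF t] B_nonneg t in auto)
    then have "\<bar>H t\<bar> * t * \<bar>?p x - ?p z\<bar> \<le> B * Y * (5 * \<bar>x - z\<bar>)"
      by (rule mult_mono[OF _ powr]) (use B_nonneg Y in auto)
    then have "(real n - 1) * (\<bar>H t\<bar> * t * \<bar>?p x - ?p z\<bar>) \<le> (real n - 1) * (B * Y * (5 * \<bar>x - z\<bar>))"
      by (rule mult_left_mono) (use n in simp)
    moreover have "(real n - 2) * \<bar>x ^ 3 - z ^ 3\<bar> \<le> (real n - 1) * (3 * (M * Y)\<^sup>2 * \<bar>x - z\<bar>)"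
      by (rule mult_mono[OF _ cube]) (use n in auto)
    ultimately show ?thesis by linarith
  qed
  also have "\<dots> = (real n - 1) * (3 * M\<^sup>2 * Y\<^sup>2 + 5 * B * Y) * \<bar>x - z\<bar>"
    by (simp add: algebra_simps power_mult_distrib)
  also have "\<dots> \<le> (real n - 1) * (1 / 2) * \<bar>x - z\<bar>"
    using n Y_bounds(3) by (intro mult_right_mono mult_left_mono) auto
  finally show ?thesis .
qed

lemma admissible_le:
  assumes "q \<in> admissible" "t \<in> {0..Y}"
  shows "\<bar>q t\<bar> \<le> M * t"
  proof -
  have "\<bar>q t\<bar> \<le> M * (if t \<in> {0<..Y} then t else 0)" using assms(1) by (simp add: admissible_def)
  then show ?thesis using assms(2) by (cases "t = 0") auto
qed

lemma power_split: "t ^ (n - 2) = t * t ^ (n - 3)" for t :: real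
  using n by (metis Suc_diff_le diff_Suc_Suc numeral_2_eq_2 numeral_3_eq_3 power_Suc)

lemma integrand_bound:
  assumes "q \<in> admissible" "t \<in> {0..Y}"
  shows "\<bar>bracket n H t (q t) * t ^ (n - 3)\<bar> \<le> (real n - 1) * M * t ^ (n - 2)"
  using mult_right_mono[OF bracket_bound[OF assms(2) admissible_le[OF assms]], of "t ^ (n - 3)"] assms(2)
  by (simp add: power_split abs_mult ac_simps)

section \<open>Integrability, continuity and the admissible class\<close>

lemma integrable:
  assumes q: "q \<in> admissible"
  shows "(\<lambda>t. bracket n H t (q t) * t ^ (n - 3)) absolutely_integrable_on {0..Y}"
proof (rule measurable_bounded_by_integrable_imp_absolutely_integrable)
  have [measurable]: "q \<in> borel_measurable (lebesgue_on {0..Y})"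
    using q by (intro measurable_restrict_space1) (simp add: admissible_def)
  have [measurable]: "(\<lambda>t. t) \<in> borel_measurable (lebesgue_on {0..Y})"
    by (intro continuous_imp_measurable_on_sets_lebesgue continuous_intros) auto
  note [measurable] = meas
  show "(\<lambda>t. bracket n H t (q t) * t ^ (n - 3)) \<in> borel_measurable (lebesgue_on {0..Y})"
    unfolding bracket_def by measurable
  show "(\<lambda>t. (real n - 1) * M * t ^ (n - 2)) integrable_on {0..Y}"
    by (intro integrable_continuous_real continuous_intros)
qed (use integrand_bound[OF q] in auto)

lemma integrable_subinterval:
  assumes "q \<in> admissible" "y \<le> Y"
  shows "(\<lambda>t. bracket n H t (q t) * t ^ (n - 3)) absolutely_integrable_on {0..y}"
  using set_integrable_subset[OF integrable[OF assms(1)], of "{0..y}"] assms(2) by auto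

text \<open>Passing to the gauge integral gives access to continuity and differentiability of
  indefinite integrals.\<close>

lemma picard_eq_integral:
  assumes "q \<in> admissible" "y \<in> {0<..Y}"
  shows "picard n H Y q y
    = y powi (2 - int n) * integral {0..y} (\<lambda>t. bracket n H t (q t) * t ^ (n - 3))"
  using assms integrable_subinterval[of q y]
  by (simp add: picard_def set_lebesgue_integral_eq_integral)

text \<open>An indefinite integral is continuous even when \<open>q\<close> is merely measurable,
  and the power of \<open>y\<close> is continuous away from 0. Hence every admissible fixed point is
  continuous on \<open>(0,Y]\<close>.\<close>

lemma picard_continuous:
  assumes "q \<in> admissible"
  shows "continuous_on {0<..Y} (picard n H Y q)"
proof -
  have "(\<lambda>t. bracket n H t (q t) * t ^ (n - 3)) integrable_on {0..Y}"
    using integrable[OF assms] by (simp add: set_lebesgue_integral_eq_integral)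
  then have "continuous_on {0<..Y} (\<lambda>y. integral {0..y} (\<lambda>t. bracket n H t (q t) * t ^ (n - 3)))"
    by (rule continuous_on_subset[OF indefinite_integral_continuous_1]) auto
  then have "continuous_on {0<..Y} (\<lambda>y. y powi (2 - int n)
      * integral {0..y} (\<lambda>t. bracket n H t (q t) * t ^ (n - 3)))"
    by (intro continuous_intros) auto
  then show ?thesis
    by (rule continuous_on_eq) (simp add: picard_eq_integral[OF assms])
qed

lemma continuous_in_admissible:
  assumes "continuous_on {0<..Y} q" "\<And>y. y \<in> {0<..Y} \<Longrightarrow> \<bar>q y\<bar> \<le> M * y"
    "\<And>y. y \<notin> {0<..Y} \<Longrightarrow> q y = 0"
  shows "q \<in> admissible"
proof -
  have "(\<lambda>t. if t \<in> {0<..Y} then q t else 0) \<in> borel_measurable borel"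
    using assms(1) by (intro borel_measurable_continuous_on_if) auto
  also have "(\<lambda>t. if t \<in> {0<..Y} then q t else 0) = q" using assms(3) by auto
  finally have "q \<in> borel_measurable lebesgue" by (simp add: measurable_completion)
  then show ?thesis using assms(2,3) by (auto simp: admissible_def)
qed

lemma admissible_zero:
  assumes "q \<in> admissible" "y \<notin> {0<..Y}"
  shows "q y = 0"
  proof -
  have "\<bar>q y\<bar> \<le> M * (if y \<in> {0<..Y} then y else 0)" using assms(1) by (simp add: admissible_def)
  then show ?thesis using assms(2) by auto
qed

lemma X_ball_eq: "q \<in> X_ball Y M \<longleftrightarrow> q \<in> admissible \<and> continuous_on {0<..Y} q"
proof
  assume "q \<in> X_ball Y M"
  then show "q \<in> admissible \<and> continuous_on {0<..Y} q"
    using continuous_in_admissible[of q] by (auto simp: X_ball_iff[OF Y])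
next
  assume q: "q \<in> admissible \<and> continuous_on {0<..Y} q"
  then show "q \<in> X_ball Y M"
    using admissible_le[of q] admissible_zero[of q] by (auto simp: X_ball_iff[OF Y])
qed

section \<open>Self-map, contraction and unique solvability\<close>

lemma picard_in_admissible:
  assumes "q \<in> admissible"
  shows "picard n H Y q \<in> admissible"
proof (rule continuous_in_admissible[OF picard_continuous[OF assms]])
  fix y assume y: "y \<in> {0<..Y}"
  show "\<bar>picard n H Y q y\<bar> \<le> M * y"
    unfolding picard_def using y weighted_mean_bound[OF n _ integrable_subinterval[OF assms]]
      integrand_bound[OF assms] by simp
qed (auto simp: picard_def)

lemma picard_contraction:
  assumes f: "f \<in> admissible" and g: "g \<in> admissible"
    and D: "\<And>s. \<bar>f s - g s\<bar> \<le> D * (if s \<in> {0<..Y} then s else 0)"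
  shows "\<bar>picard n H Y f y - picard n H Y g y\<bar> \<le> D / 2 * (if y \<in> {0<..Y} then y else 0)"
proof (cases "y \<in> {0<..Y}")
  case y: True
  let ?I = "\<lambda>q t. bracket n H t (q t) * t ^ (n - 3)"
  note int = integrable_subinterval[OF f, of y] integrable_subinterval[OF g, of y]
  have "picard n H Y f y - picard n H Y g y
      = y powi (2 - int n) * (LINT t:{0..y}|lebesgue. ?I f t - ?I g t)"
    using y int by (simp add: picard_def right_diff_distrib set_integral_diff)
  also have "\<bar>\<dots>\<bar> \<le> D / 2 * y"
  proof (rule weighted_mean_bound[OF n])
    show "(\<lambda>t. ?I f t - ?I g t) absolutely_integrable_on {0..y}"
      using int y by (intro set_integral_diff) auto
    fix t assume "t \<in> {0..y}"
    then have t: "t \<in> {0..Y}" "0 \<le> t" using y by auto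
    have fg: "\<bar>f t - g t\<bar> \<le> D * t" using D[of t] t by (auto split: if_splits)
    have "\<bar>?I f t - ?I g t\<bar> = \<bar>bracket n H t (f t) - bracket n H t (g t)\<bar> * t ^ (n - 3)"
      using t by (simp add: left_diff_distrib[symmetric] abs_mult)
    also have "\<dots> \<le> ((real n - 1) * (1 / 2) * (D * t)) * t ^ (n - 3)"
      using n t fg
      by (intro mult_right_mono order_trans[OF bracket_Lipschitz[OF t(1) admissible_le[OF f t(1)] admissible_le[OF g t(1)]]]
        mult_left_mono) auto
    finally show "\<bar>?I f t - ?I g t\<bar> \<le> (real n - 1) * (D / 2) * t ^ (n - 2)"
      by (simp add: power_split)
  qed (use y in auto)
  finally show ?thesis using y by simp
qed (auto simp: picard_def)

lemma ex1_fixed_point: "\<exists>!q. q \<in> admissible \<and> picard n H Y q = q"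
proof (rule weighted_contraction_fixed_point[where w = "\<lambda>t. if t \<in> {0<..Y} then t else 0" and M = M])
  show "(\<lambda>_. 0) \<in> admissible" using M_ge_1 unfolding admissible_def by auto
  show "\<And>f. f \<in> admissible \<Longrightarrow> picard n H Y f \<in> admissible" by (rule picard_in_admissible)
  show "\<And>f t. f \<in> admissible \<Longrightarrow> \<bar>f t\<bar> \<le> M * (if t \<in> {0<..Y} then t else 0)" by (simp add: admissible_def)
  \<comment> \<open>Measurability and the pointwise bound survive pointwise limits; continuity in
    general would not.\<close>
  show "g \<in> admissible" if F: "\<And>k. F k \<in> admissible" and lim: "\<And>t. (\<lambda>k::nat. F k t) \<longlonglongrightarrow> g t" for F g
  proof -
    have "g \<in> borel_measurable lebesgue"
      using F by (intro borel_measurable_LIMSEQ_real[OF lim]) (auto simp: admissible_def)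
    moreover have "\<bar>g t\<bar> \<le> M * (if t \<in> {0<..Y} then t else 0)" for t
      using F by (intro LIMSEQ_le_const2[OF tendsto_rabs[OF lim[of t]]]) (auto simp: admissible_def)
    ultimately show ?thesis by (simp add: admissible_def)
  qed
qed (rule picard_contraction)

text \<open>Since fixed points are continuous, solutions in the ball and admissible fixed points are
  the same functions, so uniqueness transfers too.\<close>

lemma ex1_integral_eq: "\<exists>!q. q \<in> X_ball Y M \<and> solves_integral_eq n H Y q"
proof -
  have "q \<in> X_ball Y M \<and> solves_integral_eq n H Y q \<longleftrightarrow> q \<in> admissible \<and> picard n H Y q = q" for q
  proof (cases "q \<in> admissible")
    case True
    then show ?thesis
      using picard_continuous[OF True] solves_integral_eq_iff[OF admissible_zero[OF True]]
      by (auto simp: X_ball_eq)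
  qed (simp add: X_ball_eq)
  then show ?thesis using ex1_fixed_point by simp
qed

section \<open>From the integral equation to the initial value problem\<close>

text \<open>With \<open>H\<close> and \<open>q\<close> continuous up to 0, the integrand
  \<open>G\<close> is continuous, so the quotient of its integral by \<open>y ^ (n - 2)\<close> is
  differentiable and the quotient rule gives the equation.\<close>

lemma integral_eq_imp_ivp:
  assumes H: "continuous_on {0..Y} H" and q: "q \<in> X_ball Y M" and eq: "solves_integral_eq n H Y q"
  shows "solves_singular_ivp n H Y q"
proof -
  have qd: "q \<in> admissible" and qc: "continuous_on {0<..Y} q" using q by (auto simp: X_ball_eq)
  have q0: "q 0 = 0" using admissible_zero[OF qd] by simp
  \<comment> \<open>At 0 the bound \<open>M * t\<close> squeezes \<open>q\<close> to 0; at other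
    points \<open>[0,Y]\<close> and \<open>(0,Y]\<close> have the same neighbourhood filter.\<close>
  have cont: "continuous_on {0..Y} q"
    unfolding continuous_on_def
  proof
    fix x assume x: "x \<in> {0..Y}"
    show "(q \<longlongrightarrow> q x) (at x within {0..Y})"
    proof (cases "x = 0")
      case True
      have "(q \<longlongrightarrow> 0) (at 0 within {0..Y})"
      proof (rule Lim_null_comparison)
        show "\<forall>\<^sub>F t in at 0 within {0..Y}. norm (q t) \<le> M * t"
          using admissible_le[OF qd] by (auto simp: eventually_at_filter)
        show "((\<lambda>t. M * t) \<longlongrightarrow> 0) (at 0 within {0..Y})"
          by (rule tendsto_eq_intros refl)+ simp
      qed
      then show ?thesis using True q0 by simp
    next
      case False
      with x have "x \<in> {0<..Y}" by auto
      then have "(q \<longlongrightarrow> q x) (at x within {0<..Y})" using qc by (auto simp: continuous_on_def)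
      moreover have "at x within {0..Y} = at x within {0<..Y}"
        using x False by (intro at_within_nhd[of _ "{0<..}"]) auto
      ultimately show ?thesis by simp
    qed
  qed
  define G where "G t = bracket n H t (q t) * t ^ (n - 3)" for t
  have Gc: "continuous_on {0..Y} G"
    unfolding G_def bracket_def
    by (intro continuous_intros H cont) (auto simp: add_nonneg_eq_0_iff)
  have qG: "q y = integral {0..y} G / y ^ (n - 2)" if "y \<in> {0<..Y}" for y
  proof -
    have "q y = picard n H Y q y"
      using eq solves_integral_eq_iff[OF admissible_zero[OF qd]] by simp
    also have "\<dots> = y powi (2 - int n) * integral {0..y} G"
      unfolding G_def by (rule picard_eq_integral[OF qd that])
    also have "y powi (2 - int n) = inverse (y ^ (n - 2))"
      using n by (simp add: power_int_def nat_diff_distrib power_inverse)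
    finally show ?thesis by (simp add: field_simps)
  qed
  have "\<exists>q'. (q has_real_derivative q') (at y within {0<..Y}) \<and>
          y * q' = - (real n - 2) * q y + bracket n H y (q y)" if y: "y \<in> {0<..Y}" for y
  proof -
    let ?q' = "(G y * y ^ (n - 2) - integral {0..y} G * (real (n - 2) * y ^ (n - 3))) / (y ^ (n - 2) * y ^ (n - 2))"
    have "((\<lambda>x. integral {0..x} G) has_real_derivative G y) (at y within {0<..Y})"
      by (rule DERIV_subset[OF integral_has_real_derivative[OF Gc]]) (use y in auto)
    moreover have "((\<lambda>x. x ^ (n - 2)) has_real_derivative real (n - 2) * y ^ (n - 3)) (at y within {0<..Y})"
      using DERIV_pow[of "n - 2" y "{0<..Y}"] by (simp add: diff_diff_eq)
    ultimately have "((\<lambda>x. integral {0..x} G / x ^ (n - 2)) has_real_derivative ?q') (at y within {0<..Y})"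
      by (rule DERIV_divide) (use y in simp)
    then have "(q has_real_derivative ?q') (at y within {0<..Y})"
      by (rule has_field_derivative_transform_within[of _ _ _ _ 1]) (use y qG in auto)
    moreover have "y * ?q' = - (real n - 2) * q y + bracket n H y (q y)"
    proof -
      have k: "real (n - 2) = real n - 2" using n by simp
      \<comment> \<open>Here \<open>b\<close> stands for the bracket, \<open>R\<close> for
        \<open>y ^ (n - 3)\<close> and \<open>I\<close> for the integral of \<open>G\<close>, so
        that \<open>y ^ (n - 2)\<close> is \<open>y * R\<close> and \<open>q y\<close> is
        \<open>I / (y * R)\<close>.\<close>
      have key: "y * ((b * R * (y * R) - I * (k * R)) / ((y * R) * (y * R))) = - k * (I / (y * R)) + b"
        if "R \<noteq> 0" for b R I k :: real
        using y that by (simp add: divide_simps) (simp add: algebra_simps)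
      then show ?thesis
        unfolding qG[OF y] G_def[of y] power_split k by (intro key) (use y in simp)
    qed
    ultimately show ?thesis by blast
  qed
  then show ?thesis
    using cont q0 by (simp add: solves_singular_ivp_def bracket_def algebra_simps)
qed

end

section \<open>Choice of the constants\<close>

theorem proposition2p2:
  fixes n :: nat and Y0 :: real and H :: "real \<Rightarrow> real"
  assumes "n \<ge> 3"
    and "Y0 > 0"
    and "H \<in> borel_measurable (lebesgue_on {0..Y0})"
    and "bounded (H ` {0..Y0})"
  shows "\<exists>M0>0. \<forall>M\<ge>M0. \<exists>Y1\<in>{0<..Y0}. \<forall>Y\<in>{0<..Y1}.
           (\<exists>!q. q \<in> X_ball Y M \<and> solves_integral_eq n H Y q) \<and>
           (continuous_on {0..Y0} H \<longrightarrow>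
              (\<forall>q\<in>X_ball Y M. solves_integral_eq n H Y q \<longrightarrow> solves_singular_ivp n H Y q))"
proof -
  obtain B where "\<forall>x\<in>H ` {0..Y0}. norm x \<le> B"
    using assms(4) unfolding bounded_iff by blast
  then have B: "\<bar>H t\<bar> \<le> B" if "t \<in> {0..Y0}" for t using that by simp
  have B0: "0 \<le> B" using B[of 0] assms(2) by auto
  show ?thesis
  \<comment> \<open>This threshold for \<open>M\<close> is exactly \<open>MB\<close>; it depends
    only on the bound for \<open>H\<close>.\<close>
  proof (intro exI[of _ "3 * B + 1"] conjI allI impI)
    show "3 * B + 1 > 0" using B0 by simp
    fix M assume M: "3 * B + 1 \<le> M"
    define K where "K = 12 * M\<^sup>2 + 20 * B"
    have K: "K > 0" using M B0 by (auto simp: K_def intro!: add_pos_nonneg)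
    show "\<exists>Y1\<in>{0<..Y0}. \<forall>Y\<in>{0<..Y1}.
           (\<exists>!q. q \<in> X_ball Y M \<and> solves_integral_eq n H Y q) \<and>
           (continuous_on {0..Y0} H \<longrightarrow>
              (\<forall>q\<in>X_ball Y M. solves_integral_eq n H Y q \<longrightarrow> solves_singular_ivp n H Y q))"
    \<comment> \<open>\<open>Y \<le> 1 / K\<close> is \<open>YM\<close>, and
      \<open>Y \<le> Y0\<close> keeps the interval inside the domain where \<open>H\<close> is
      controlled.\<close>
    proof (intro bexI[of _ "min Y0 (1 / K)"] ballI)
      show "min Y0 (1 / K) \<in> {0<..Y0}" using K assms(2) by auto
      fix Y assume Y: "Y \<in> {0<..min Y0 (1 / K)}"
      then have sub: "{0..Y} \<subseteq> {0..Y0}" by auto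
      interpret small_interval n H B M Y
      proof
        show "H \<in> borel_measurable (lebesgue_on {0..Y})"
          using assms(3) sub by (rule measurable_restrict_mono)
        show "Y * (12 * M\<^sup>2 + 20 * B) \<le> 1"
          using Y K unfolding K_def[symmetric] by (simp add: pos_le_divide_eq)
      qed (use assms(1) Y B M in auto)
      show "(\<exists>!q. q \<in> X_ball Y M \<and> solves_integral_eq n H Y q) \<and>
           (continuous_on {0..Y0} H \<longrightarrow>
              (\<forall>q\<in>X_ball Y M. solves_integral_eq n H Y q \<longrightarrow> solves_singular_ivp n H Y q))"
        using ex1_integral_eq integral_eq_imp_ivp continuous_on_subset[OF _ sub] by blast
    qed
  qed
qed

end
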